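(* Let $V, Y, Q, Q^*, \Lambda, \Lambda_\circ, f, u, \|\cdot\|_\circ$ and $T_\rho$ be as in the context. Let $\rho>0$ be such that $T_\rho$ is a contraction in $\|\cdot\|_\circ$ with contraction factor $q(\rho)<1$. Let $v\in V$, let $\widetilde v_\rho\in V$ be arbitrary (a numerical approximation of $v_\rho:=T_\rho v$), let $y$ be a function in $Y$, and put $$\eta_\rho:=v-\widetilde v_\rho,\qquad \delta_\rho:=\|\eta_\rho\|_\circ,\qquad \tau:=y-\rho\Lambda Qv,$$ $$M_\oplus(\eta_\rho,\tau):=\bigl(\Lambda_\circ Q\eta_\rho+\tau,\;Q\eta_\rho+\Lambda_\circ^{-1}\tau\bigr)^{1/2}+\frac{1}{\sqrt{\lambda^\circ_\ominus}}\,|\!|\!|Q^*y+\rho f|\!|\!|,$$ where $|\!|\!|w^*|\!|\!|:=\sup_{w\in V}\frac{\langle w^*,w\rangle}{\|w\|_\circ}$ for $w^*\in V^*$ (supremum over $w\ne 0$). Then the error $e=v-u$ is subject to the estimate $$\|e\|_\circ\in\left[\max\left\{0,\ \frac{\delta_\rho-M_\oplus(\eta_\rho,\tau)}{1+q(\rho)}\right\},\ \frac{\delta_\rho+M_\oplus(\eta_\rho,\tau)}{1-q(\rho)}\right].$$ If $Q^*y+\rho f=0$, then $$M_\oplus^2(\eta_\rho,\tau)=(\Lambda_\circ Q\eta_\rho,Q\eta_\rho)+(\Lambda_\circ^{-1}\tau,\tau)-2(Q\eta_\rho,\tau).$$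
   Context: Setting. $V$ is a reflexive Banach space with norm $\|\cdot\|_V$, $V^*$ is its dual, and $\langle v^*,v\rangle$ is the duality pairing. $Y$ is a Hilbert space with scalar product $(\cdot,\cdot)$ and norm $\|\cdot\|$. $Q:V\to Y$ is a bounded linear operator with conjugate $Q^*:Y\to V^*$, i.e. $(y,Qw)=\langle Q^*y,w\rangle$ for all $y\in Y$, $w\in V$, and there is a constant $c>0$ such that $\|Qw\|\ge c\|w\|_V$ for all $w\in V$. $f\in\mathcal V$, where $\mathcal V$ is a Hilbert space intermediate between $V$ and $V^*$ ($V\subset\mathcal V\subset V^*$), so that $f$ is also regarded as an element of $V^*$. $\Lambda,\Lambda_\circ:Y\to Y$ are bounded linear Hermitian operators for which there are constants $0<\lambda^\circ_\ominus\le\lambda^\circ_\oplus$ and $0<\lambda_\ominus<\lambda_\oplus$ with $$\lambda^\circ_\ominus\|y\|^2\le(\Lambda_\circ y,y)\le\lambda^\circ_\oplus\|y\|^2,\qquad \lambda_\ominus\|y\|^2\le(\Lambda y,y)\le\lambda_\oplus\|y\|^2\qquad\forall y\in Y.$$ For $w\in V$, $\|w\|_\circ:=(\Lambda_\circ Qw,Qw)^{1/2}$. The function $u\in V$ is the solution of $$(\Lambda Qu,Qw)=\langle f,w\rangle\qquad\forall w\in V.$$ For $\rho>0$, the map $T_\rho:V\to V$ sends $v\in V$ to the unique $v_\rho=T_\rho v\in V$ such that $$(\Lambda_\circ Qv_\rho,Qw)=(\Lambda_\circ Qv,Qw)-\rho\bigl((\Lambda Qv,Qw)-\langle f,w\rangle\bigr)\qquad\forall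 w\in V.$$ That $T_\rho$ is a contraction with factor $q(\rho)$ means $\|T_\rho v_1-T_\rho v_2\|_\circ\le q(\rho)\|v_1-v_2\|_\circ$ for all $v_1,v_2\in V$.
   Formalization: The printed formulas fail in simple one-dimensional examples; proved with Q*y − ρf in place of Q*y + ρf (in M and in the last condition), factor max(1, 1/√λ°_⊖) in place of 1/√λ°_⊖, and cross term +2(Qη_ρ, τ) in place of −2(Qη_ρ, τ). *)

theory Defs
  imports "HOL-Analysis.Analysis"
begin

definition reflexive_space :: "'v::real_normed_vector itself \<Rightarrow> bool" where
  "reflexive_space _ \<longleftrightarrow>
     (\<forall>F :: ('v \<Rightarrow>\<^sub>L real) \<Rightarrow>\<^sub>L real. \<exists>v :: 'v. \<forall>\<phi> :: 'v \<Rightarrow>\<^sub>L real. blinfun_apply F \<phi> = blinfun_apply \<phi> v)"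

definition conjugate ::
  "('v::real_normed_vector \<Rightarrow>\<^sub>L 'y::real_inner) \<Rightarrow> 'y \<Rightarrow> ('v \<Rightarrow>\<^sub>L real)" where
  "conjugate Q y = blinfun_inner_right y o\<^sub>L Q"

lemma conjugate_apply: "conjugate Q y w = y \<bullet> Q w"
  by (simp add: conjugate_def)

definition norm0 ::
  "('y::real_inner \<Rightarrow>\<^sub>L 'y) \<Rightarrow> ('v::real_normed_vector \<Rightarrow>\<^sub>L 'y) \<Rightarrow> 'v \<Rightarrow> real" where
  "norm0 \<Lambda>\<^sub>0 Q w = sqrt (\<Lambda>\<^sub>0 (Q w) \<bullet> Q w)"

(* The vector w = 0 contributes 0 / 0 = 0. This leaves the supremum over nonzero w
   unchanged, and gives the value 0 when the space is trivial. *)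
definition dual_norm0 ::
  "('y::real_inner \<Rightarrow>\<^sub>L 'y) \<Rightarrow> ('v::real_normed_vector \<Rightarrow>\<^sub>L 'y) \<Rightarrow> ('v \<Rightarrow>\<^sub>L real) \<Rightarrow> real" where
  "dual_norm0 \<Lambda>\<^sub>0 Q \<phi> = (SUP w. \<phi> w / norm0 \<Lambda>\<^sub>0 Q w)"

(* z = T_rho v in weak form *)
definition iteration_step ::
  "('y::real_inner \<Rightarrow>\<^sub>L 'y) \<Rightarrow> ('y \<Rightarrow>\<^sub>L 'y) \<Rightarrow> ('v::real_normed_vector \<Rightarrow>\<^sub>L 'y) \<Rightarrow>
   ('v \<Rightarrow>\<^sub>L real) \<Rightarrow> real \<Rightarrow> 'v \<Rightarrow> 'v \<Rightarrow> bool" where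
  "iteration_step \<Lambda>\<^sub>0 \<Lambda> Q F \<rho> v z \<longleftrightarrow>
     (\<forall>w. \<Lambda>\<^sub>0 (Q z) \<bullet> Q w = \<Lambda>\<^sub>0 (Q v) \<bullet> Q w - \<rho> * (\<Lambda> (Q v) \<bullet> Q w - F w))"

(* The majorant differs from the printed formula in two places.
   Sign of F: the source prints "Q* y + rho f", but the problem (Lambda Q u, Q w) = <f, w>
   and tau = y - rho Lambda Q v give, for v_rho = T_rho v and eta = v - v',
     (Lambda0 Q (v_rho - v'), Q w) = (Lambda0 Q eta + tau, Q w) - <Q* y - rho f, w>.
   Factor: the source prints 1 / sqrt lam0. As the dual norm is taken with respect to norm0,
   the factor needed is 1, so 1 / sqrt lam0 suffices only for lam0 <= 1. The maximum below is
   the printed factor for the lower bound min lam0 1 and equals it whenever lam0 <= 1.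
   Expanding the first radicand gives the cross term +2 (Q eta, tau); the source prints -2. *)
definition majorant ::
  "('y::real_inner \<Rightarrow>\<^sub>L 'y) \<Rightarrow> ('v::real_normed_vector \<Rightarrow>\<^sub>L 'y) \<Rightarrow> real \<Rightarrow>
   ('v \<Rightarrow>\<^sub>L real) \<Rightarrow> real \<Rightarrow> 'y \<Rightarrow> 'v \<Rightarrow> 'y \<Rightarrow> real" where
  "majorant \<Lambda>\<^sub>0 Q lam0 F \<rho> y \<eta> \<tau> =
     sqrt ((\<Lambda>\<^sub>0 (Q \<eta>) + \<tau>) \<bullet> (Q \<eta> + inv (blinfun_apply \<Lambda>\<^sub>0) \<tau>))
     + max 1 (1 / sqrt lam0) * dual_norm0 \<Lambda>\<^sub>0 Q (conjugate Q y - \<rho> *\<^sub>R F)"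

end

theory Submission
  imports Defs
begin

text \<open>
  The solution \<open>u\<close> is a fixed point of the contraction \<open>T\<close>, so
  \<open>\<parallel>v - T v\<parallel>\<close> controls \<open>\<parallel>v - u\<parallel>\<close> from both sides with the factors \<open>1 \<plusminus> q\<close>, and it differs
  from \<open>\<delta> = \<parallel>v - vt\<parallel>\<close> by at most \<open>\<parallel>r\<parallel>\<close>, \<open>r = T v - vt\<close>. Testing the equation
  \<open>(\<Lambda>\<^sub>0 Q r, Q w) = (\<Lambda>\<^sub>0 Q \<eta> + \<tau>, Q w) - \<langle>Q\<^sup>* y - \<rho> f, w\<rangle>\<close> with \<open>w = r\<close> and using the
  Cauchy-Schwarz inequality of the form \<open>(\<Lambda>\<^sub>0 \<cdot>, \<cdot>)\<close> bounds \<open>\<parallel>r\<parallel>\<close> by the majorant.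
\<close>

section \<open>Operators with a coercive or positive form\<close>

text \<open>This gives \<open>inv (blinfun_apply A)\<close> in the majorant its meaning. Coercivity
  forces a trivial kernel; solutions of \<open>A x = b\<close> are the fixed points of the damped
  iteration \<open>g\<close>, which contracts the complete space with factor
  \<open>sqrt k\<close>.\<close>

lemma coercive_imp_bij:
  fixes A :: "'y::{real_inner, complete_space} \<Rightarrow>\<^sub>L 'y"
  assumes l: "0 < l" and coercive: "\<And>z. l * (norm z)\<^sup>2 \<le> A z \<bullet> z"
  shows "bij (blinfun_apply A)"
proof (rule bijI)
  show "inj (blinfun_apply A)"
  proof (rule injI)
    fix x z assume "A x = A z"
    then have "l * (norm (x - z))\<^sup>2 \<le> 0"
      using coercive[of "x - z"] by (simp add: blinfun.diff_right)
    then show "x = z"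
      using l by (simp add: mult_le_0_iff)
  qed
  show "surj (blinfun_apply A)"
    unfolding surj_def
  proof
    fix b
    \<comment> \<open>Adding \<open>l\<close> keeps \<open>K\<close> positive and at least
      \<open>l\<close>, so that \<open>k\<close> is nonnegative. The damping \<open>s\<close>
      minimises \<open>1 - 2 * s * l + s\<^sup>2 * K\<^sup>2\<close>, and \<open>k\<close> is the
      minimum.\<close>
    define K where "K = norm A + l"
    define s where "s = l / K\<^sup>2"
    define k where "k = 1 - l\<^sup>2 / K\<^sup>2"
    define g where "g = (\<lambda>x. x - s *\<^sub>R (A x - b))"
    have K: "0 < K" "l \<le> K" "norm A \<le> K"
      using l by (auto simp: K_def add_nonneg_pos)
    have s: "0 < s"
      using l K by (simp add: s_def)
    have k: "0 \<le> k" "k < 1"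
      using l K by (auto simp: k_def divide_le_eq power_mono)
    have step: "dist (g x) (g z) \<le> sqrt k * dist x z" for x z
    proof -
      define d where "d = x - z"
      have "(norm (A d))\<^sup>2 \<le> (K * norm d)\<^sup>2"
        by (rule power_mono)
          (use norm_blinfun[of A d] mult_right_mono[OF K(3) norm_ge_zero, of d] in auto)
      then have "s\<^sup>2 * (norm (A d))\<^sup>2 \<le> s\<^sup>2 * (K\<^sup>2 * (norm d)\<^sup>2)"
        by (intro mult_left_mono) (auto simp: power_mult_distrib)
      moreover have "2 * s * (l * (norm d)\<^sup>2) \<le> 2 * s * (A d \<bullet> d)"
        using s coercive[of d] by (intro mult_left_mono) auto
      moreover have "g x - g z = d - s *\<^sub>R A d"
        by (simp add: g_def d_def blinfun.diff_right algebra_simps)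
      moreover have "(norm (d - s *\<^sub>R A d))\<^sup>2
          = (norm d)\<^sup>2 - 2 * s * (A d \<bullet> d) + s\<^sup>2 * (norm (A d))\<^sup>2"
        unfolding power2_norm_eq_inner
        by (simp add: inner_diff inner_commute power2_eq_square algebra_simps)
      moreover have "(norm d)\<^sup>2 - 2 * s * (l * (norm d)\<^sup>2) + s\<^sup>2 * (K\<^sup>2 * (norm d)\<^sup>2)
          = k * (norm d)\<^sup>2"
        using K by (simp add: s_def k_def field_simps power2_eq_square)
      ultimately have "(norm (g x - g z))\<^sup>2 \<le> k * (norm d)\<^sup>2"
        by simp
      then have "norm (g x - g z) \<le> sqrt (k * (norm d)\<^sup>2)"
        by (simp add: real_le_rsqrt)
      then show ?thesis
        by (simp add: dist_norm d_def real_sqrt_mult)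
    qed
    have "\<exists>!x. g x = x"
      by (rule banach_fix_type[where c = "sqrt k"]) (use k step in auto)
    then obtain x where "g x = x"
      by blast
    then have "b = A x"
      using s by (simp add: g_def)
    then show "\<exists>x. b = A x" ..
  qed
qed

text \<open>The form at \<open>x - t *\<^sub>R z\<close> is a nonnegative quadratic in
  \<open>t\<close>. Since the form may be degenerate, a vanishing leading coefficient is treated
  separately.\<close>

lemma positive_form_Cauchy_Schwarz:
  fixes A :: "'y::real_inner \<Rightarrow>\<^sub>L 'y"
  assumes sym: "\<And>x z. A x \<bullet> z = x \<bullet> A z" and pos: "\<And>z. 0 \<le> A z \<bullet> z"
  shows "\<bar>A x \<bullet> z\<bar> \<le> sqrt (A x \<bullet> x) * sqrt (A z \<bullet> z)"
proof -
  have quadratic: "0 \<le> A x \<bullet> x - 2 * t * (A x \<bullet> z) + t\<^sup>2 * (A z \<bullet> z)" for t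
  proof -
    have "A z \<bullet> x = A x \<bullet> z"
      using sym[of x z] by (simp add: inner_commute)
    then have "A (x - t *\<^sub>R z) \<bullet> (x - t *\<^sub>R z)
        = A x \<bullet> x - 2 * t * (A x \<bullet> z) + t\<^sup>2 * (A z \<bullet> z)"
      by (simp add: blinfun.diff_right blinfun.scaleR_right inner_diff power2_eq_square
          algebra_simps)
    then show ?thesis
      using pos[of "x - t *\<^sub>R z"] by simp
  qed
  have "(A x \<bullet> z)\<^sup>2 \<le> (A x \<bullet> x) * (A z \<bullet> z)"
  proof (cases "A z \<bullet> z = 0")
    case True
    have "A x \<bullet> z = 0"
    proof (rule ccontr)
      assume "A x \<bullet> z \<noteq> 0"
      \<comment> \<open>The quadratic is now affine in \<open>t\<close>, and this \<open>t\<close>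
        gives it the value -1.\<close>
      then show False
        using quadratic[of "(A x \<bullet> x + 1) / (2 * (A x \<bullet> z))"] pos[of x] True
        by (simp add: field_simps)
    qed
    then show ?thesis
      using True by simp
  next
    case False
    then have "0 < A z \<bullet> z"
      using pos[of z] by simp
    \<comment> \<open>The chosen \<open>t\<close> is the minimiser of the quadratic.\<close>
    then show ?thesis
      using quadratic[of "(A x \<bullet> z) / (A z \<bullet> z)"]
      by (simp add: field_simps power2_eq_square)
  qed
  then have "sqrt ((A x \<bullet> z)\<^sup>2) \<le> sqrt ((A x \<bullet> x) * (A z \<bullet> z))"
    by (rule real_sqrt_le_mono)
  then show ?thesis
    by (simp add: real_sqrt_mult)
qed

section \<open>The energy norm and its dual norm\<close>

lemma norm0_power2:
  fixes A :: "'y::real_inner \<Rightarrow>\<^sub>L 'y"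
  assumes "\<And>z. 0 \<le> A z \<bullet> z"
  shows "(norm0 A Q w)\<^sup>2 = A (Q w) \<bullet> Q w"
  using assms by (simp add: norm0_def)

lemma norm0_nonneg:
  fixes A :: "'y::real_inner \<Rightarrow>\<^sub>L 'y"
  assumes "\<And>z. 0 \<le> A z \<bullet> z"
  shows "0 \<le> norm0 A Q w"
  using assms by (simp add: norm0_def)

lemma norm0_minus: "norm0 A Q (- w) = norm0 A Q w"
  by (simp add: norm0_def blinfun.minus_right)

lemma norm0_diff_commute: "norm0 A Q (x - z) = norm0 A Q (z - x)"
  using norm0_minus[of A Q "x - z"] by simp

lemma norm0_triangle:
  fixes A :: "'y::real_inner \<Rightarrow>\<^sub>L 'y"
  assumes sym: "\<And>x z. A x \<bullet> z = x \<bullet> A z" and pos: "\<And>z. 0 \<le> A z \<bullet> z"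
  shows "norm0 A Q (x + z) \<le> norm0 A Q x + norm0 A Q z"
proof (rule power2_le_imp_le)
  have "A (Q x) \<bullet> Q z \<le> norm0 A Q x * norm0 A Q z"
    using positive_form_Cauchy_Schwarz[OF sym pos, of "Q x" "Q z"] by (simp add: norm0_def)
  moreover have "A (Q z) \<bullet> Q x = A (Q x) \<bullet> Q z"
    using sym[of "Q x" "Q z"] by (simp add: inner_commute)
  ultimately show "(norm0 A Q (x + z))\<^sup>2 \<le> (norm0 A Q x + norm0 A Q z)\<^sup>2"
    by (simp add: power2_sum norm0_power2[OF pos] blinfun.add_right inner_add)
  show "0 \<le> norm0 A Q x + norm0 A Q z"
    by (simp add: norm0_nonneg[OF pos])
qed

lemma norm0_triangle_sub:
  fixes A :: "'y::real_inner \<Rightarrow>\<^sub>L 'y"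
  assumes "\<And>x z. A x \<bullet> z = x \<bullet> A z" and "\<And>z. 0 \<le> A z \<bullet> z"
  shows "norm0 A Q (x - z) \<le> norm0 A Q (x - w) + norm0 A Q (w - z)"
  using norm0_triangle[OF assms, of Q "x - w" "w - z"] by simp

text \<open>Domination of the norm of the space makes \<open>norm0\<close> definite and the
  quotients in \<open>dual_norm0\<close> bounded.\<close>

lemma norm0_lower_bound:
  fixes A :: "'y::real_inner \<Rightarrow>\<^sub>L 'y"
    and Q :: "'v::real_normed_vector \<Rightarrow>\<^sub>L 'y"
  assumes l: "0 < l" and coercive: "\<And>z. l * (norm z)\<^sup>2 \<le> A z \<bullet> z"
    and c: "0 < c" and below: "\<And>w. c * norm w \<le> norm (Q w)"
  shows "sqrt l * c * norm w \<le> norm0 A Q w"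
proof -
  have "sqrt l * (c * norm w) \<le> sqrt l * norm (Q w)"
    using below[of w] l by (intro mult_left_mono) auto
  also have "\<dots> = sqrt (l * (norm (Q w))\<^sup>2)"
    by (simp add: real_sqrt_mult)
  also have "\<dots> \<le> norm0 A Q w"
    unfolding norm0_def by (intro real_sqrt_le_mono coercive)
  finally show ?thesis
    by (simp add: mult.assoc)
qed

text \<open>A real supremum is informative only over a bounded set. Here
  \<open>norm \<phi> / m\<close> bounds all quotients, so each one lies below
  \<open>dual_norm0\<close>.\<close>

lemma
  fixes A :: "'y::real_inner \<Rightarrow>\<^sub>L 'y"
    and Q :: "'v::real_normed_vector \<Rightarrow>\<^sub>L 'y"
  assumes l: "0 < l" and coercive: "\<And>z. l * (norm z)\<^sup>2 \<le> A z \<bullet> z"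
    and c: "0 < c" and below: "\<And>w. c * norm w \<le> norm (Q w)"
  shows dual_norm0_bound: "blinfun_apply \<phi> w \<le> dual_norm0 A Q \<phi> * norm0 A Q w"
    and dual_norm0_nonneg: "0 \<le> dual_norm0 A Q \<phi>"
proof -
  define m where "m = sqrt l * c"
  have m: "0 < m"
    using l c by (simp add: m_def)
  have lower: "m * norm x \<le> norm0 A Q x" for x
    unfolding m_def using norm0_lower_bound[OF assms] .
  have "\<phi> x / norm0 A Q x \<le> norm \<phi> / m" for x
  proof (cases "x = 0")
    case False
    then have "0 < m * norm x"
      using m by simp
    then have pos: "0 < norm0 A Q x"
      using lower[of x] by linarith
    have "\<phi> x \<le> norm \<phi> * norm x"
      using norm_blinfun[of \<phi> x] by simp
    also have "\<dots> = norm \<phi> / m * (m * norm x)"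
      using m by simp
    also have "\<dots> \<le> norm \<phi> / m * norm0 A Q x"
      using lower[of x] m by (intro mult_left_mono) auto
    finally show ?thesis
      using pos by (simp add: pos_divide_le_eq)
  qed (use m in simp)
  then have "bdd_above (range (\<lambda>x. \<phi> x / norm0 A Q x))"
    by (intro bdd_aboveI2)
  then have upper: "\<phi> x / norm0 A Q x \<le> dual_norm0 A Q \<phi>" for x
    unfolding dual_norm0_def by (intro cSUP_upper) auto
  \<comment> \<open>The quotient at \<open>0\<close> is 0 / 0 = 0, which covers the trivial space
    too.\<close>
  from upper[of 0] show "0 \<le> dual_norm0 A Q \<phi>"
    by simp
  show "\<phi> w \<le> dual_norm0 A Q \<phi> * norm0 A Q w"
  proof (cases "w = 0")
    case False
    then have "0 < m * norm w"
      using m by simp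
    then have "0 < norm0 A Q w"
      using lower[of w] by linarith
    then show ?thesis
      using upper[of w] by (simp add: pos_divide_le_eq)
  qed (simp add: norm0_def)
qed

lemma dual_norm0_zero: "dual_norm0 A Q 0 = 0"
  by (simp add: dual_norm0_def)

section \<open>The majorant and the residual of one iteration step\<close>

text \<open>The first factor is the image under \<open>A\<close> of the second, so the radicand is a
  value of the quadratic form: it is nonnegative for coercive \<open>A\<close>, and Cauchy-Schwarz
  applies.\<close>

lemma majorant_radicand:
  assumes "surj (blinfun_apply A)"
  shows "(A x + \<tau>) \<bullet> (x + inv (blinfun_apply A) \<tau>)
    = A (x + inv (blinfun_apply A) \<tau>) \<bullet> (x + inv (blinfun_apply A) \<tau>)"
  by (simp add: blinfun.add_right surj_f_inv_f[OF assms])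

text \<open>Only the square root survives when the functional vanishes. Symmetry of \<open>A\<close>
  makes both cross terms equal to \<open>Q \<eta> \<bullet> \<tau>\<close>, hence the factor
  +2.\<close>

lemma majorant_power2:
  fixes A :: "'y::{real_inner, complete_space} \<Rightarrow>\<^sub>L 'y"
  assumes sym: "\<And>x z. A x \<bullet> z = x \<bullet> A z"
    and l: "0 < l" and coercive: "\<And>z. l * (norm z)\<^sup>2 \<le> A z \<bullet> z"
    and eq: "conjugate Q y - \<rho> *\<^sub>R F = 0"
  shows "(majorant A Q l F \<rho> y \<eta> \<tau>)\<^sup>2
    = A (Q \<eta>) \<bullet> Q \<eta> + inv (blinfun_apply A) \<tau> \<bullet> \<tau> + 2 * (Q \<eta> \<bullet> \<tau>)"
proof -
  have surj: "surj (blinfun_apply A)"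
    using coercive_imp_bij[OF l coercive] by (rule bij_is_surj)
  define b where "b = inv (blinfun_apply A) \<tau>"
  have Ab: "A b = \<tau>"
    by (simp add: b_def surj_f_inv_f[OF surj])
  have "0 \<le> A (Q \<eta> + b) \<bullet> (Q \<eta> + b)"
    using order_trans[OF _ coercive] l by simp
  then have "(majorant A Q l F \<rho> y \<eta> \<tau>)\<^sup>2 = A (Q \<eta> + b) \<bullet> (Q \<eta> + b)"
    by (simp add: majorant_def eq dual_norm0_zero majorant_radicand[OF surj] b_def)
  also have "\<dots> = A (Q \<eta>) \<bullet> Q \<eta> + b \<bullet> \<tau> + 2 * (Q \<eta> \<bullet> \<tau>)"
    using sym[of "Q \<eta>" b]
    by (simp add: blinfun.add_right inner_add Ab inner_commute)
  finally show ?thesis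
    by (simp add: b_def)
qed

text \<open>The exact iterate \<open>z\<close> enters only through its weak equation, so the bound
  involves just \<open>v\<close>, the approximation \<open>x\<close> and the free field
  \<open>y\<close>.\<close>

lemma iteration_step_dist_le_majorant:
  fixes A L :: "'y::{real_inner, complete_space} \<Rightarrow>\<^sub>L 'y"
    and Q :: "'v::real_normed_vector \<Rightarrow>\<^sub>L 'y"
  assumes sym: "\<And>x z. A x \<bullet> z = x \<bullet> A z"
    and l: "0 < l" and coercive: "\<And>z. l * (norm z)\<^sup>2 \<le> A z \<bullet> z"
    and c: "0 < c" and below: "\<And>w. c * norm w \<le> norm (Q w)"
    and step: "iteration_step A L Q F \<rho> v z"
  shows "norm0 A Q (z - x) \<le> majorant A Q l F \<rho> y (v - x) (y - \<rho> *\<^sub>R L (Q v))"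
proof -
  define r where "r = z - x"
  define \<tau> where "\<tau> = y - \<rho> *\<^sub>R L (Q v)"
  define \<phi> where "\<phi> = conjugate Q y - \<rho> *\<^sub>R F"
  define p where "p = Q (v - x) + inv (blinfun_apply A) \<tau>"
  define M where "M = majorant A Q l F \<rho> y (v - x) \<tau>"
  have pos: "0 \<le> A z \<bullet> z" for z
    using order_trans[OF _ coercive] l by simp
  have surj: "surj (blinfun_apply A)"
    using coercive_imp_bij[OF l coercive] by (rule bij_is_surj)
  have M: "M = sqrt (A p \<bullet> p) + max 1 (1 / sqrt l) * dual_norm0 A Q \<phi>"
    by (simp add: M_def majorant_def majorant_radicand[OF surj] p_def \<phi>_def)
  \<comment> \<open>The contributions of \<open>y\<close> to \<open>A p\<close> and to
    \<open>\<phi>\<close> cancel, leaving the step equation tested with \<open>r\<close>.\<close>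
  have "(norm0 A Q r)\<^sup>2 = A p \<bullet> Q r + \<phi> (- r)"
    using step unfolding iteration_step_def
    by (simp add: norm0_power2[OF pos] r_def p_def \<phi>_def \<tau>_def conjugate_apply
        surj_f_inv_f[OF surj] blinfun.diff_right blinfun.add_right blinfun.minus_right
        blinfun.diff_left blinfun.scaleR_left inner_diff inner_add algebra_simps)
  also have "\<dots> \<le> sqrt (A p \<bullet> p) * norm0 A Q r + dual_norm0 A Q \<phi> * norm0 A Q r"
    using positive_form_Cauchy_Schwarz[OF sym pos, of p "Q r"]
      dual_norm0_bound[OF l coercive c below, of \<phi> "- r"]
    by (simp add: norm0_def blinfun.minus_right)
  \<comment> \<open>The factor 1 has sufficed so far; the maximum in \<open>M\<close> can only
    enlarge the nonnegative dual norm term.\<close>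
  also have "\<dots> \<le> M * norm0 A Q r"
    using mult_right_mono[OF _ dual_norm0_nonneg[OF l coercive c below],
        of 1 "max 1 (1 / sqrt l)" \<phi>]
    by (auto simp: M simp flip: distrib_right intro!: mult_right_mono norm0_nonneg pos)
  finally have "norm0 A Q r * norm0 A Q r \<le> M * norm0 A Q r"
    by (simp add: power2_eq_square)
  moreover have "0 \<le> M"
    using dual_norm0_nonneg[OF l coercive c below, of \<phi>] pos[of p] by (simp add: M)
  \<comment> \<open>Cancelling \<open>norm0 A Q r\<close> requires it to be nonzero; otherwise
    \<open>0 \<le> M\<close> suffices.\<close>
  ultimately have "norm0 A Q r \<le> M"
    using norm0_nonneg[OF pos, of Q r] by (cases "norm0 A Q r = 0") auto
  then show ?thesis
    by (simp add: r_def M_def \<tau>_def)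
qed

text \<open>At the solution the correction term vanishes, and testing with \<open>z - u\<close>
  leaves the form of \<open>z - u\<close> equal to 0. So \<open>u\<close> is a fixed point up to
  \<open>norm0\<close>, which suffices for triangle inequalities.\<close>

lemma iteration_step_solution:
  fixes A L :: "'y::real_inner \<Rightarrow>\<^sub>L 'y"
    and Q :: "'v::real_normed_vector \<Rightarrow>\<^sub>L 'y"
    and F :: "'v \<Rightarrow>\<^sub>L real"
  assumes sol: "\<And>w. L (Q u) \<bullet> Q w = F w" and step: "iteration_step A L Q F \<rho> u z"
  shows "norm0 A Q (z - u) = 0"
  using step[unfolded iteration_step_def, rule_format, of "z - u"]
  by (simp add: norm0_def sol blinfun.diff_right inner_diff)

theorem theorem4p2:
  fixes Q :: "'v::banach \<Rightarrow>\<^sub>L 'y::{real_inner, complete_space}"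
    and \<Lambda> \<Lambda>\<^sub>0 :: "'y \<Rightarrow>\<^sub>L 'y"
    and \<iota> :: "'v \<Rightarrow>\<^sub>L 'h::{real_inner, complete_space}"
    and \<kappa> :: "'h \<Rightarrow>\<^sub>L ('v \<Rightarrow>\<^sub>L real)"
    and f :: 'h
    and u v vt \<eta> :: 'v
    and y \<tau> :: 'y
    and T :: "'v \<Rightarrow> 'v"
    and c lam0 Lam0 lam Lam \<rho> q \<delta> :: real
  assumes "reflexive_space TYPE('v)"
    and "inj (blinfun_apply \<iota>)" and "inj (blinfun_apply \<kappa>)"
    and "c > 0" and "\<And>w. norm (Q w) \<ge> c * norm w"
    and "\<And>x z. \<Lambda>\<^sub>0 x \<bullet> z = x \<bullet> \<Lambda>\<^sub>0 z"
    and "\<And>x z. \<Lambda> x \<bullet> z = x \<bullet> \<Lambda> z"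
    and "0 < lam0" and "lam0 \<le> Lam0"
    and "\<And>z. lam0 * (norm z)\<^sup>2 \<le> \<Lambda>\<^sub>0 z \<bullet> z" and "\<And>z. \<Lambda>\<^sub>0 z \<bullet> z \<le> Lam0 * (norm z)\<^sup>2"
    and "0 < lam" and "lam < Lam"
    and "\<And>z. lam * (norm z)\<^sup>2 \<le> \<Lambda> z \<bullet> z" and "\<And>z. \<Lambda> z \<bullet> z \<le> Lam * (norm z)\<^sup>2"
    and "\<And>w. \<Lambda> (Q u) \<bullet> Q w = \<kappa> f w"
    and "\<rho> > 0"
    and "\<And>x. iteration_step \<Lambda>\<^sub>0 \<Lambda> Q (\<kappa> f) \<rho> x (T x)"
    and "0 \<le> q" and "q < 1"
    and "\<And>x z. norm0 \<Lambda>\<^sub>0 Q (T x - T z) \<le> q * norm0 \<Lambda>\<^sub>0 Q (x - z)"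
    and "\<eta> = v - vt"
    and "\<delta> = norm0 \<Lambda>\<^sub>0 Q \<eta>"
    and "\<tau> = y - \<rho> *\<^sub>R \<Lambda> (Q v)"
  shows "norm0 \<Lambda>\<^sub>0 Q (v - u) \<in>
           {max 0 ((\<delta> - majorant \<Lambda>\<^sub>0 Q lam0 (\<kappa> f) \<rho> y \<eta> \<tau>) / (1 + q)) ..
            (\<delta> + majorant \<Lambda>\<^sub>0 Q lam0 (\<kappa> f) \<rho> y \<eta> \<tau>) / (1 - q)}
         \<and> (conjugate Q y - \<rho> *\<^sub>R \<kappa> f = 0 \<longrightarrow>
             (majorant \<Lambda>\<^sub>0 Q lam0 (\<kappa> f) \<rho> y \<eta> \<tau>)\<^sup>2 =
               \<Lambda>\<^sub>0 (Q \<eta>) \<bullet> Q \<eta> + inv (blinfun_apply \<Lambda>\<^sub>0) \<tau> \<bullet> \<tau> + 2 * (Q \<eta> \<bullet> \<tau>))"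
proof -
  note sym = assms(6) and lam0 = assms(8) and coercive = assms(10)
  define N where "N = norm0 \<Lambda>\<^sub>0 Q"
  define M where "M = majorant \<Lambda>\<^sub>0 Q lam0 (\<kappa> f) \<rho> y \<eta> \<tau>"
  have pos: "0 \<le> \<Lambda>\<^sub>0 z \<bullet> z" for z
    using order_trans[OF _ coercive] lam0 by simp
  have triangle: "N (x - z) \<le> N (x - w) + N (w - z)" for x z w
    unfolding N_def by (rule norm0_triangle_sub[OF sym pos])
  have commute: "N (x - z) = N (z - x)" for x z
    unfolding N_def by (rule norm0_diff_commute)
  have nonneg: "0 \<le> N x" for x
    unfolding N_def by (rule norm0_nonneg[OF pos])
  have fixed: "N (T u - u) = 0"
    unfolding N_def by (rule iteration_step_solution[OF assms(16) assms(18)])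
  have contraction: "N (T v - T u) \<le> q * N (v - u)"
    unfolding N_def by (rule assms(21))
  have residual: "N (T v - vt) \<le> M"
    unfolding N_def M_def \<open>\<eta> = v - vt\<close> \<open>\<tau> = y - \<rho> *\<^sub>R \<Lambda> (Q v)\<close>
    using iteration_step_dist_le_majorant[OF sym lam0 coercive assms(4,5,18)] .
  have \<delta>: "\<delta> = N (v - vt)"
    by (simp add: N_def assms)
  have Tv: "N (T v - u) \<le> q * N (v - u)"
    using triangle[of "T v" u "T u"] fixed contraction by linarith
  \<comment> \<open>Path from \<open>v\<close> through \<open>u\<close> and \<open>T v\<close> to
    \<open>vt\<close>; with \<open>Tv\<close> the factor \<open>1 + q\<close> appears.\<close>
  have "\<delta> \<le> N (v - u) + N (T v - u) + M"
    using triangle[of v vt u] triangle[of u vt "T v"] residual commute[of u "T v"] \<delta>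
    by linarith
  with Tv have lower: "(\<delta> - M) / (1 + q) \<le> N (v - u)"
    using \<open>0 \<le> q\<close> by (simp add: pos_divide_le_eq algebra_simps)
  \<comment> \<open>Path from \<open>v\<close> through \<open>vt\<close> and \<open>T v\<close> to
    \<open>u\<close>; the last leg is at most \<open>q * N (v - u)\<close> and is absorbed on the
    left because \<open>q < 1\<close>.\<close>
  have "N (v - u) \<le> \<delta> + M + N (T v - u)"
    using triangle[of v u vt] triangle[of vt u "T v"] residual commute[of vt "T v"] \<delta>
    by linarith
  with Tv have upper: "N (v - u) \<le> (\<delta> + M) / (1 - q)"
    using \<open>q < 1\<close> by (simp add: pos_le_divide_eq algebra_simps)
  show ?thesis
    using lower upper nonneg[of "v - u"]
      majorant_power2[OF sym lam0 coercive, of Q y \<rho> "\<kappa> f" \<eta> \<tau>]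
    by (simp add: N_def M_def)
qed

end
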